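(* Let $S=\langle S;\le\rangle$ be a bounded ordered set. Suppose that for each $i\in S$ we are given a bounded ordered set $\langle P_i;\le_i\rangle$, and for each pair $i\le j$ in $S$ a $0$-separating $\{0,1\}$-preserving monotone map $\psi_{ij}\colon P_i\to P_j$, such that $\psi_{ii}$ is the identity map of $P_i$ for all $i\in S$ and $\psi_{jk}\circ\psi_{ij}=\psi_{ik}$ whenever $i\le j\le k$ in $S$ (that is, $F(i)=\langle P_i;\le_i\rangle$, $F(i\le j)=\psi_{ij}$ defines a functor $F$ from $S$, viewed as a category, to $\mathbf{Cat}_{\mathrm{b}}$). Then $F$ is representable by principal lattice congruences: there exist a bounded lattice $L$, a $\{0,1\}$-sublattice $E(i)$ of $L$ for each $i\in S$ such that $E(i)\subseteq E(j)$ whenever $i\le j$, and order isomorphisms $\xi_i\colon\langle P_i;\le_i\rangle\to\langle\mathrm{Princ}(E(i));\subseteq\rangle$ for $i\in S$, such that for all $i\le j$ in $S$, \[ \zeta_{E(i),E(j)}\circ\xi_i=\xi_j\circ\psi_{ij}. \]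
   Context: An ordered set is bounded if it has a least element $0$ and a greatest element $1$; a lattice is bounded if it has $0$ and $1$. For bounded ordered sets $P,Q$, a map $\psi\colon P\to Q$ is a $\{0,1\}$-preserving monotone map if $\psi(0_P)=0_Q$, $\psi(1_P)=1_Q$ and $x\le_P y$ implies $\psi(x)\le_Q\psi(y)$; it is $0$-separating if moreover $\psi^{-1}(0_Q)=\{0_P\}$. $\mathbf{Cat}_{\mathrm{b}}$ denotes the category of bounded ordered sets with $0$-separating $\{0,1\}$-preserving monotone maps. For a lattice $L$ and $x,y\in L$, $\mathrm{con}_L(x,y)$ denotes the smallest congruence of $L$ containing $(x,y)$ (a principal congruence), and $\mathrm{Princ}(L)$ is the set of principal congruences of $L$, ordered by inclusion. A $\{0,1\}$-sublattice of a bounded lattice $L$ is a sublattice containing $0_L$ and $1_L$. For $\{0,1\}$-sublattices $K\subseteq J$ of $L$, the map $\zeta_{K,J}\colon\mathrm{Princ}(K)\to\mathrm{Princ}(J)$ is defined by $\mathrm{con}_K(x,y)\mapsto\mathrm{con}_J(x,y)$ (it is well defined, as $\mathrm{con}_J(x,y)$ is the congruence of $J$ generated by $\mathrm{con}_K(x,y)$). Maps are composed right to left. *)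

theory Defs
  imports Main
begin

definition po_on :: "'a set \<Rightarrow> ('a \<Rightarrow> 'a \<Rightarrow> bool) \<Rightarrow> bool" where
  "po_on A le \<longleftrightarrow> (\<forall>x\<in>A. le x x) \<and>
     (\<forall>x\<in>A. \<forall>y\<in>A. le x y \<and> le y x \<longrightarrow> x = y) \<and>
     (\<forall>x\<in>A. \<forall>y\<in>A. \<forall>z\<in>A. le x y \<and> le y z \<longrightarrow> le x z)"

definition bounded_po :: "'a set \<Rightarrow> ('a \<Rightarrow> 'a \<Rightarrow> bool) \<Rightarrow> bool" where
  "bounded_po A le \<longleftrightarrow> po_on A le \<and> (\<exists>b\<in>A. \<exists>t\<in>A. \<forall>x\<in>A. le b x \<and> le x t)"

definition bot_of :: "'a set \<Rightarrow> ('a \<Rightarrow> 'a \<Rightarrow> bool) \<Rightarrow> 'a" where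
  "bot_of A le = (THE b. b \<in> A \<and> (\<forall>x\<in>A. le b x))"

definition top_of :: "'a set \<Rightarrow> ('a \<Rightarrow> 'a \<Rightarrow> bool) \<Rightarrow> 'a" where
  "top_of A le = (THE t. t \<in> A \<and> (\<forall>x\<in>A. le x t))"

definition sep01_mono :: "'a set \<Rightarrow> ('a \<Rightarrow> 'a \<Rightarrow> bool) \<Rightarrow> 'b set \<Rightarrow> ('b \<Rightarrow> 'b \<Rightarrow> bool)
    \<Rightarrow> ('a \<Rightarrow> 'b) \<Rightarrow> bool" where
  "sep01_mono A leA B leB f \<longleftrightarrow>
     f ` A \<subseteq> B \<and>
     f (bot_of A leA) = bot_of B leB \<and> f (top_of A leA) = top_of B leB \<and>
     (\<forall>x\<in>A. \<forall>y\<in>A. leA x y \<longrightarrow> leB (f x) (f y)) \<and>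
     (\<forall>x\<in>A. f x = bot_of B leB \<longrightarrow> x = bot_of A leA)"

definition lattice_on :: "'a set \<Rightarrow> ('a \<Rightarrow> 'a \<Rightarrow> 'a) \<Rightarrow> ('a \<Rightarrow> 'a \<Rightarrow> 'a) \<Rightarrow> bool" where
  "lattice_on L j m \<longleftrightarrow>
     (\<forall>x\<in>L. \<forall>y\<in>L. j x y \<in> L \<and> m x y \<in> L) \<and>
     (\<forall>x\<in>L. \<forall>y\<in>L. j x y = j y x \<and> m x y = m y x) \<and>
     (\<forall>x\<in>L. \<forall>y\<in>L. \<forall>z\<in>L. j (j x y) z = j x (j y z) \<and> m (m x y) z = m x (m y z)) \<and>
     (\<forall>x\<in>L. \<forall>y\<in>L. j x (m x y) = x \<and> m x (j x y) = x)"

definition lat_le :: "('a \<Rightarrow> 'a \<Rightarrow> 'a) \<Rightarrow> 'a \<Rightarrow> 'a \<Rightarrow> bool" where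
  "lat_le m x y \<longleftrightarrow> m x y = x"

definition bounded_lattice_on :: "'a set \<Rightarrow> ('a \<Rightarrow> 'a \<Rightarrow> 'a) \<Rightarrow> ('a \<Rightarrow> 'a \<Rightarrow> 'a) \<Rightarrow> bool" where
  "bounded_lattice_on L j m \<longleftrightarrow> lattice_on L j m \<and>
     (\<exists>z\<in>L. \<exists>u\<in>L. \<forall>x\<in>L. lat_le m z x \<and> lat_le m x u)"

definition sublattice01 :: "'a set \<Rightarrow> ('a \<Rightarrow> 'a \<Rightarrow> 'a) \<Rightarrow> ('a \<Rightarrow> 'a \<Rightarrow> 'a) \<Rightarrow> 'a set \<Rightarrow> bool" where
  "sublattice01 L j m K \<longleftrightarrow> K \<subseteq> L \<and>
     (\<forall>x\<in>K. \<forall>y\<in>K. j x y \<in> K \<and> m x y \<in> K) \<and>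
     bot_of L (lat_le m) \<in> K \<and> top_of L (lat_le m) \<in> K"

definition lat_congruence :: "'a set \<Rightarrow> ('a \<Rightarrow> 'a \<Rightarrow> 'a) \<Rightarrow> ('a \<Rightarrow> 'a \<Rightarrow> 'a) \<Rightarrow> ('a \<times> 'a) set \<Rightarrow> bool" where
  "lat_congruence K j m \<theta> \<longleftrightarrow> equiv K \<theta> \<and>
     (\<forall>a b c d. (a, b) \<in> \<theta> \<and> (c, d) \<in> \<theta> \<longrightarrow> (j a c, j b d) \<in> \<theta> \<and> (m a c, m b d) \<in> \<theta>)"

definition con :: "'a set \<Rightarrow> ('a \<Rightarrow> 'a \<Rightarrow> 'a) \<Rightarrow> ('a \<Rightarrow> 'a \<Rightarrow> 'a) \<Rightarrow> 'a \<Rightarrow> 'a \<Rightarrow> ('a \<times> 'a) set" where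
  "con K j m x y = \<Inter> {\<theta>. lat_congruence K j m \<theta> \<and> (x, y) \<in> \<theta>}"

definition Princ :: "'a set \<Rightarrow> ('a \<Rightarrow> 'a \<Rightarrow> 'a) \<Rightarrow> ('a \<Rightarrow> 'a \<Rightarrow> 'a) \<Rightarrow> ('a \<times> 'a) set set" where
  "Princ K j m = {con K j m x y | x y. x \<in> K \<and> y \<in> K}"

definition zeta :: "'a set \<Rightarrow> 'a set \<Rightarrow> ('a \<Rightarrow> 'a \<Rightarrow> 'a) \<Rightarrow> ('a \<Rightarrow> 'a \<Rightarrow> 'a)
    \<Rightarrow> ('a \<times> 'a) set \<Rightarrow> ('a \<times> 'a) set" where
  "zeta K J j m \<theta> = (let (x, y) = (SOME (x, y). x \<in> K \<and> y \<in> K \<and> \<theta> = con K j m x y)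
                      in con J j m x y)"

end

theory Submission
  imports Defs
begin

text \<open>
  Each nonzero \<open>p \<in> P\<^sub>i\<close> becomes a vertex \<open>v = (i, p)\<close> with two points \<open>ap v\<close>, \<open>bp v\<close>, and
  \<open>L\<close> is a closure system on the set of all points. Its proper members lie inside the points of
  two comparable vertices (or are one of two filler atoms, which provide complements) and satisfy
  Horn clauses: a member with \<open>bp v\<close> contains \<open>ap v\<close> (unless \<open>p = 1\<close>), and for \<open>v\<close> below \<open>w\<close> a
  member with \<open>ap v\<close> and \<open>bp w\<close> contains \<open>bp v\<close>. The second clause makes collapsing the edge
  \<open>{ap w} \<subset> {ap w, bp w}\<close> collapse the edge of \<open>v\<close>. Here \<open>(i, p)\<close> is below \<open>(i, q)\<close> if
  \<open>p \<le>\<^sub>i q\<close>, and \<open>(i, p)\<close> and \<open>(j, \<psi>\<^sub>i\<^sub>j p)\<close> are below each other.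
  The sublattice \<open>E(k)\<close> consists of the closed sets with vertices \<open>(i, p)\<close>, \<open>i \<le> k\<close>. For
  \<open>q \<noteq> 1\<close> in \<open>P\<^sub>k\<close>, adding \<open>bp (i, p)\<close> wherever \<open>ap (i, p)\<close> is present and \<open>\<psi>\<^sub>i\<^sub>k p \<le>\<^sub>k q\<close> is
  a closure operator on \<open>E(k)\<close> that preserves meets, so its kernel is a congruence; it collapses
  exactly the edges \<open>(i, p)\<close> with \<open>\<psi>\<^sub>i\<^sub>k p \<le>\<^sub>k q\<close>. Every pair of distinct comparable members of
  \<open>E(k)\<close> generates either the congruence of an edge or, by complementation, the full congruence.
\<close>

section \<open>Principal congruences\<close>

lemma bot_of_eqI:
  assumes "po_on A le" "b \<in> A" "\<And>x. x \<in> A \<Longrightarrow> le b x"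
  shows "bot_of A le = b"
  unfolding bot_of_def using assms unfolding po_on_def by (intro the_equality) blast+

lemma top_of_eqI:
  assumes "po_on A le" "t \<in> A" "\<And>x. x \<in> A \<Longrightarrow> le x t"
  shows "top_of A le = t"
  unfolding top_of_def using assms unfolding po_on_def by (intro the_equality) blast+

lemma bounded_po_bot_top:
  assumes "bounded_po A le"
  shows "bot_of A le \<in> A" "top_of A le \<in> A"
    "x \<in> A \<Longrightarrow> le (bot_of A le) x" "x \<in> A \<Longrightarrow> le x (top_of A le)"
proof -
  from assms obtain b t where bt: "po_on A le" "b \<in> A" "t \<in> A" "\<And>x. x \<in> A \<Longrightarrow> le b x \<and> le x t"
    unfolding bounded_po_def by blast
  then have "bot_of A le = b" "top_of A le = t"
    by (simp_all add: bot_of_eqI top_of_eqI)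
  with bt show "bot_of A le \<in> A" "top_of A le \<in> A"
    "x \<in> A \<Longrightarrow> le (bot_of A le) x" "x \<in> A \<Longrightarrow> le x (top_of A le)"
    by auto
qed

definition op_closed :: "'a set \<Rightarrow> ('a \<Rightarrow> 'a \<Rightarrow> 'a) \<Rightarrow> ('a \<Rightarrow> 'a \<Rightarrow> 'a) \<Rightarrow> bool" where
  "op_closed K j m \<longleftrightarrow> (\<forall>x\<in>K. \<forall>y\<in>K. j x y \<in> K \<and> m x y \<in> K)"

lemma lat_congruence_iff:
  "lat_congruence K j m \<theta> \<longleftrightarrow> \<theta> \<subseteq> K \<times> K \<and> (\<forall>x\<in>K. (x, x) \<in> \<theta>) \<and>
     (\<forall>x y. (x, y) \<in> \<theta> \<longrightarrow> (y, x) \<in> \<theta>) \<and>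
     (\<forall>x y z. (x, y) \<in> \<theta> \<longrightarrow> (y, z) \<in> \<theta> \<longrightarrow> (x, z) \<in> \<theta>) \<and>
     (\<forall>a b c d. (a, b) \<in> \<theta> \<and> (c, d) \<in> \<theta> \<longrightarrow> (j a c, j b d) \<in> \<theta> \<and> (m a c, m b d) \<in> \<theta>)"
  unfolding lat_congruence_def equiv_def refl_on_def sym_def trans_def by blast

lemma lat_congruence_Times: "op_closed K j m \<Longrightarrow> lat_congruence K j m (K \<times> K)"
  unfolding lat_congruence_iff op_closed_def by blast

lemma lat_congruence_Id_on: "op_closed K j m \<Longrightarrow> lat_congruence K j m (Id_on K)"
  unfolding lat_congruence_iff op_closed_def by blast

lemma lat_congruence_Inter:
  assumes "F \<noteq> {}" and F: "\<And>\<theta>. \<theta> \<in> F \<Longrightarrow> lat_congruence K j m \<theta>"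
  shows "lat_congruence K j m (\<Inter>F)"
  using F unfolding lat_congruence_iff
  apply (intro conjI)
  subgoal using \<open>F \<noteq> {}\<close> by blast
  subgoal by blast
  subgoal by blast
  subgoal by (meson InterE InterI)
  subgoal by (meson InterE InterI)
  done

lemma lat_congruence_con:
  assumes "op_closed K j m" "x \<in> K" "y \<in> K"
  shows "lat_congruence K j m (con K j m x y)"
  unfolding con_def
  by (rule lat_congruence_Inter) (use lat_congruence_Times[OF assms(1)] assms(2,3) in blast)+

lemma con_generator: "(x, y) \<in> con K j m x y"
  unfolding con_def by blast

lemma con_least: "lat_congruence K j m \<theta> \<Longrightarrow> (x, y) \<in> \<theta> \<Longrightarrow> con K j m x y \<subseteq> \<theta>"
  unfolding con_def by blast

lemma con_refl:
  assumes "op_closed K j m" "x \<in> K"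
  shows "con K j m x x = Id_on K"
proof
  show "con K j m x x \<subseteq> Id_on K"
    using assms by (intro con_least lat_congruence_Id_on) auto
  show "Id_on K \<subseteq> con K j m x x"
    using lat_congruence_con[OF assms(1,2,2)] unfolding lat_congruence_iff by blast
qed

lemma con_subset_conI:
  assumes "op_closed K j m" "x' \<in> K" "y' \<in> K" "(x, y) \<in> con K j m x' y'"
  shows "con K j m x y \<subseteq> con K j m x' y'"
  using assms by (intro con_least lat_congruence_con)

lemma lat_congruence_restrict:
  assumes "op_closed K j m" "K \<subseteq> J" and J: "lat_congruence J j m \<theta>"
  shows "lat_congruence K j m (\<theta> \<inter> K \<times> K)"
  unfolding lat_congruence_iff
proof (intro conjI allI impI)
  fix a b c d assume *: "(a, b) \<in> \<theta> \<inter> K \<times> K \<and> (c, d) \<in> \<theta> \<inter> K \<times> K"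
  then have "(j a c, j b d) \<in> \<theta> \<and> (m a c, m b d) \<in> \<theta>"
    using J unfolding lat_congruence_iff by blast
  with * show "(j a c, j b d) \<in> \<theta> \<inter> K \<times> K" "(m a c, m b d) \<in> \<theta> \<inter> K \<times> K"
    using assms(1) unfolding op_closed_def by auto
next
  show "\<forall>x\<in>K. (x, x) \<in> \<theta> \<inter> K \<times> K"
    using J \<open>K \<subseteq> J\<close> unfolding lat_congruence_iff by blast
next
  fix x y assume "(x, y) \<in> \<theta> \<inter> K \<times> K"
  then show "(y, x) \<in> \<theta> \<inter> K \<times> K"
    using J unfolding lat_congruence_iff by blast
next
  fix x y z assume "(x, y) \<in> \<theta> \<inter> K \<times> K" "(y, z) \<in> \<theta> \<inter> K \<times> K"
  moreover from this have "(x, z) \<in> \<theta>"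
    using J unfolding lat_congruence_iff by blast
  ultimately show "(x, z) \<in> \<theta> \<inter> K \<times> K" by blast
qed blast

text \<open>The trace on \<open>K\<close> of a congruence of \<open>J\<close> is a congruence of
  \<open>K\<close>.\<close>

lemma con_restrict_subset:
  assumes K: "op_closed K j m" and J: "op_closed J j m" and "K \<subseteq> J" and xy: "x \<in> K" "y \<in> K"
  shows "con K j m x y \<subseteq> con J j m x y"
proof -
  have J': "lat_congruence J j m (con J j m x y)"
    using assms by (intro lat_congruence_con) auto
  have "lat_congruence K j m (con J j m x y \<inter> K \<times> K)"
    using K \<open>K \<subseteq> J\<close> J' by (rule lat_congruence_restrict)
  then show ?thesis
    using con_least[of K j m _ x y] con_generator[of x y J j m] xy by blast
qed

text \<open>\<open>zeta\<close> evaluates at a generating pair picked by \<open>SOME\<close>. The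
  choice is harmless: two pairs with the same congruence in \<open>K\<close> lie in each other's
  congruence in \<open>J\<close>.\<close>

lemma zeta_con:
  assumes K: "op_closed K j m" and J: "op_closed J j m" and "K \<subseteq> J" and xy: "x \<in> K" "y \<in> K"
  shows "zeta K J j m (con K j m x y) = con J j m x y"
proof -
  let ?R = "\<lambda>(x', y'). x' \<in> K \<and> y' \<in> K \<and> con K j m x y = con K j m x' y'"
  obtain x' y' where s: "(SOME u. ?R u) = (x', y')" by fastforce
  have "?R (SOME u. ?R u)" by (rule someI[of ?R "(x, y)"]) (use xy in simp)
  then have xy': "x' \<in> K" "y' \<in> K" and eq: "con K j m x y = con K j m x' y'"
    unfolding s by auto
  have "(x', y') \<in> con J j m x y"
    using con_restrict_subset[OF K J \<open>K \<subseteq> J\<close> xy] con_generator[of x' y' K j m] eq by auto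
  moreover have "(x, y) \<in> con J j m x' y'"
    using con_restrict_subset[OF K J \<open>K \<subseteq> J\<close> xy'] con_generator[of x y K j m] eq by auto
  ultimately have "con J j m x y = con J j m x' y'"
    using con_subset_conI[OF J] xy xy' \<open>K \<subseteq> J\<close> by (meson subset_antisym subsetD)
  then show ?thesis
    unfolding zeta_def s[unfolded] by (simp add: s)
qed

section \<open>A lattice of closed sets\<close>

text \<open>The assumptions say exactly that all points are distinct. The relation \<open>lo\<close>
  (below) and the predicate \<open>one\<close> (vertices of color 1) stay arbitrary here.\<close>

locale frame =
  fixes ap bp :: "'v \<Rightarrow> 'a" and u1 u2 :: 'a
    and lo :: "'v \<Rightarrow> 'v \<Rightarrow> bool" and one :: "'v \<Rightarrow> bool"
  assumes ap_eq [simp]: "ap v = ap w \<longleftrightarrow> v = w"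
    and bp_eq [simp]: "bp v = bp w \<longleftrightarrow> v = w"
    and ap_neq [simp]: "ap v \<noteq> bp w" "ap v \<noteq> u1" "ap v \<noteq> u2"
    and bp_neq [simp]: "bp v \<noteq> u1" "bp v \<noteq> u2"
    and u_neq [simp]: "u1 \<noteq> u2"
begin

lemmas neqs [simp] = ap_neq[symmetric] bp_neq[symmetric] u_neq[symmetric]

definition block :: "'a set \<Rightarrow> bool" where
  "block B \<longleftrightarrow> (\<exists>v w. (v = w \<or> lo v w) \<and> B = {ap v, bp v, ap w, bp w}) \<or> B = {u1} \<or> B = {u2}"

definition small :: "'a set \<Rightarrow> bool" where
  "small C \<longleftrightarrow> (\<exists>B. block B \<and> C \<subseteq> B)"

text \<open>Exempting the vertices with \<open>one v\<close> from the first clause makes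
  \<open>{bp v}\<close> an atom, so that collapsing the edge of \<open>v\<close> collapses
  everything.\<close>

definition horn :: "'a set \<Rightarrow> bool" where
  "horn C \<longleftrightarrow> (\<forall>v. \<not> one v \<longrightarrow> bp v \<in> C \<longrightarrow> ap v \<in> C) \<and>
     (\<forall>v w. lo v w \<longrightarrow> ap v \<in> C \<longrightarrow> bp w \<in> C \<longrightarrow> bp v \<in> C)"

definition Cl :: "'a set set" where
  "Cl = {C. C = UNIV \<or> small C \<and> horn C}"

definition cl :: "'a set \<Rightarrow> 'a set" where
  "cl A = \<Inter> {C \<in> Cl. A \<subseteq> C}"

definition jn :: "'a set \<Rightarrow> 'a set \<Rightarrow> 'a set" where
  "jn X Y = cl (X \<union> Y)"

lemma small_subset: "small C \<Longrightarrow> D \<subseteq> C \<Longrightarrow> small D"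
  unfolding small_def by (meson subset_trans)

lemma horn_Cl: "C \<in> Cl \<Longrightarrow> horn C"
  unfolding Cl_def horn_def by auto

lemma small_u1: "small C \<Longrightarrow> u1 \<in> C \<Longrightarrow> C = {u1}"
  unfolding small_def block_def by auto

lemma small_u2: "small C \<Longrightarrow> u2 \<in> C \<Longrightarrow> C = {u2}"
  unfolding small_def block_def by auto

lemma Cl_cases: "C \<in> Cl \<Longrightarrow> C \<noteq> UNIV \<Longrightarrow> small C"
  unfolding Cl_def by auto

lemma UNIV_Cl [simp]: "UNIV \<in> Cl"
  unfolding Cl_def by simp

text \<open>Smallness passes from \<open>C\<close> to the intersection. The case in mind is
  \<open>D = Q W\<close>, which contains both fillers and hence is never small.\<close>

lemma Int_horn_Cl: "C \<in> Cl \<Longrightarrow> horn D \<Longrightarrow> C \<noteq> UNIV \<Longrightarrow> C \<inter> D \<in> Cl"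
  using small_subset[of C "C \<inter> D"] horn_Cl[of C] unfolding Cl_def
  by (auto simp: horn_def)

lemma Inter_Cl:
  assumes "F \<subseteq> Cl"
  shows "\<Inter>F \<in> Cl"
proof (cases "F \<subseteq> {UNIV}")
  case True
  then have "\<Inter>F = UNIV" by blast
  then show ?thesis by (simp only: UNIV_Cl)
next
  case False
  then obtain C where C: "C \<in> F" "C \<noteq> UNIV" by auto
  then have "small C" using assms Cl_cases by auto
  then have "small (\<Inter>F)" using Inter_lower[OF C(1)] by (rule small_subset)
  moreover have "horn (\<Inter>F)"
    using assms horn_Cl unfolding horn_def by (meson InterE InterI subsetD)
  ultimately show ?thesis unfolding Cl_def by blast
qed

lemma cl_Cl [simp]: "cl A \<in> Cl"
  unfolding cl_def by (rule Inter_Cl) auto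

lemma cl_superset: "A \<subseteq> cl A"
  unfolding cl_def by auto

lemma cl_least: "C \<in> Cl \<Longrightarrow> A \<subseteq> C \<Longrightarrow> cl A \<subseteq> C"
  unfolding cl_def by auto

lemma cl_eq: "C \<in> Cl \<Longrightarrow> cl C = C"
  by (simp add: cl_least cl_superset subset_antisym)

lemma cl_mono: "A \<subseteq> B \<Longrightarrow> cl A \<subseteq> cl B"
  by (meson cl_Cl cl_least cl_superset order_trans)

lemma cl_Un_cl: "cl (cl A \<union> B) = cl (A \<union> B)"
proof
  show "cl (cl A \<union> B) \<subseteq> cl (A \<union> B)"
    using cl_mono[of A "A \<union> B"] cl_superset[of "A \<union> B"] by (intro cl_least) auto
  show "cl (A \<union> B) \<subseteq> cl (cl A \<union> B)"
    using cl_superset[of A] by (intro cl_mono) auto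
qed

lemma jn_superset: "X \<union> Y \<subseteq> jn X Y"
  unfolding jn_def by (rule cl_superset)

lemma jn_upper: "X \<subseteq> jn X Y" "Y \<subseteq> jn X Y"
  using cl_superset[of "X \<union> Y"] unfolding jn_def by auto

lemma jn_least: "C \<in> Cl \<Longrightarrow> X \<subseteq> C \<Longrightarrow> Y \<subseteq> C \<Longrightarrow> jn X Y \<subseteq> C"
  unfolding jn_def by (rule cl_least) auto

lemma jn_absorb: "X \<in> Cl \<Longrightarrow> Y \<subseteq> X \<Longrightarrow> jn X Y = X"
  unfolding jn_def by (simp add: cl_eq Un_absorb2)

lemma jn_commute: "jn X Y = jn Y X"
  unfolding jn_def by (simp add: Un_commute)

lemma jn_Cl [simp]: "jn X Y \<in> Cl"
  unfolding jn_def by simp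

text \<open>\<open>{u1}\<close> is the only small set containing \<open>u1\<close>, so the filler
  has no proper common upper bound with any other nonempty set.\<close>

lemma jn_u1:
  assumes "Y \<noteq> {}" "Y \<noteq> {u1}"
  shows "jn {u1} Y = UNIV"
proof (rule ccontr)
  assume "jn {u1} Y \<noteq> UNIV"
  then have "jn {u1} Y = {u1}"
    using jn_upper(1)[of "{u1}" Y] by (intro small_u1 Cl_cases) simp_all
  then show False using jn_upper(2)[of Y "{u1}"] assms by auto
qed

lemma jn_u2:
  assumes "Y \<noteq> {}" "Y \<noteq> {u2}"
  shows "jn {u2} Y = UNIV"
proof (rule ccontr)
  assume "jn {u2} Y \<noteq> UNIV"
  then have "jn {u2} Y = {u2}"
    using jn_upper(1)[of "{u2}" Y] by (intro small_u2 Cl_cases) simp_all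
  then show False using jn_upper(2)[of Y "{u2}"] assms by auto
qed

lemma block_intros [simp]: "block {u1}" "block {u2}" "block {ap v, bp v}"
    "lo v w \<Longrightarrow> block {ap v, bp v, ap w, bp w}"
  unfolding block_def by blast+

lemma smallI: "block B \<Longrightarrow> C \<subseteq> B \<Longrightarrow> small C"
  unfolding small_def by blast

lemma small_atoms [simp]: "small {}" "small {u1}" "small {u2}" "small {ap v}" "small {bp v}"
    "small {ap v, bp v}" "lo v w \<Longrightarrow> small {ap v, ap w}"
  using smallI[of "{u1}"] smallI[of "{u2}"] smallI[of "{ap v, bp v}"]
    smallI[of "{ap v, bp v, ap w, bp w}"] by simp_all

lemma Cl_atoms [simp]: "{} \<in> Cl" "{u1} \<in> Cl" "{u2} \<in> Cl" "{ap v} \<in> Cl" "{ap v, bp v} \<in> Cl"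
    "one v \<Longrightarrow> {bp v} \<in> Cl" "lo v w \<Longrightarrow> {ap v, ap w} \<in> Cl"
  unfolding Cl_def by (auto simp: horn_def)

lemma Int_Cl: "X \<in> Cl \<Longrightarrow> Y \<in> Cl \<Longrightarrow> X \<inter> Y \<in> Cl"
  using Inter_Cl[of "{X, Y}"] by simp

lemma bounded_lattice_Cl: "bounded_lattice_on Cl jn (\<inter>)"
proof -
  have "lattice_on Cl jn (\<inter>)"
    unfolding lattice_on_def
  proof (intro conjI ballI)
    fix X Y Z
    show "jn (jn X Y) Z = jn X (jn Y Z)"
      using cl_Un_cl[of "X \<union> Y" Z] cl_Un_cl[of "Y \<union> Z" X] unfolding jn_def
      by (simp add: ac_simps)
  qed (simp_all add: Int_Cl jn_absorb jn_commute Int_ac Int_absorb2 jn_upper)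
  moreover have "\<exists>z\<in>Cl. \<exists>u\<in>Cl. \<forall>x\<in>Cl. lat_le (\<inter>) z x \<and> lat_le (\<inter>) x u"
    by (rule bexI[of _ "{}"], rule bexI[of _ UNIV]) (auto simp: lat_le_def)
  ultimately show ?thesis unfolding bounded_lattice_on_def by blast
qed

lemma po_Cl: "po_on Cl (lat_le (\<inter>))"
  unfolding po_on_def lat_le_def by auto

section \<open>The sublattices over sets of vertices\<close>

definition Q :: "'v set \<Rightarrow> 'a set" where
  "Q W = {u1, u2} \<union> ap ` W \<union> bp ` W"

definition El :: "'v set \<Rightarrow> 'a set set" where
  "El W = {C \<in> Cl. C = UNIV \<or> C \<subseteq> Q W}"

lemma horn_Q: "horn (Q W)"
  unfolding horn_def Q_def by auto

lemma in_Q [simp]: "ap v \<in> Q W \<longleftrightarrow> v \<in> W" "bp v \<in> Q W \<longleftrightarrow> v \<in> W" "u1 \<in> Q W" "u2 \<in> Q W"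
  unfolding Q_def by auto

lemma El_mono: "W \<subseteq> W' \<Longrightarrow> El W \<subseteq> El W'"
  unfolding El_def Q_def by blast

lemma El_Cl: "X \<in> El W \<Longrightarrow> X \<in> Cl"
  unfolding El_def by auto

lemma El_Q: "X \<in> El W \<Longrightarrow> X \<noteq> UNIV \<Longrightarrow> X \<subseteq> Q W"
  unfolding El_def by auto

text \<open>A join taken in \<open>Cl\<close> might leave \<open>Q W\<close>. It does not: every
  Horn clause concludes at a vertex of one of its premises, so \<open>Q W\<close> satisfies the
  clauses, and cutting a proper join down to \<open>Q W\<close> leaves a closed upper bound.\<close>

lemma jn_El:
  assumes X: "X \<in> El W" and Y: "Y \<in> El W"
  shows "jn X Y \<in> El W"
proof (cases "jn X Y = UNIV")
  case False
  have "X \<subseteq> Q W" "Y \<subseteq> Q W"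
    using False jn_superset[of X Y] El_Q[OF X] El_Q[OF Y] by auto
  moreover have "jn X Y \<inter> Q W \<in> Cl"
    using False by (intro Int_horn_Cl horn_Q) (simp_all add: jn_def)
  ultimately have "jn X Y \<subseteq> jn X Y \<inter> Q W"
    using jn_superset[of X Y] by (intro jn_least) auto
  then show ?thesis by (auto simp: El_def jn_def)
qed (simp add: El_def)

lemma op_closed_El: "op_closed (El W) jn (\<inter>)"
  unfolding op_closed_def using jn_El by (auto simp: El_def Int_Cl)

lemma El_atoms [simp]: "{} \<in> El W" "{u1} \<in> El W" "{u2} \<in> El W" "UNIV \<in> El W"
    "v \<in> W \<Longrightarrow> {ap v} \<in> El W" "v \<in> W \<Longrightarrow> {ap v, bp v} \<in> El W"
    "one v \<Longrightarrow> v \<in> W \<Longrightarrow> {bp v} \<in> El W" "lo v w \<Longrightarrow> v \<in> W \<Longrightarrow> w \<in> W \<Longrightarrow> {ap v, ap w} \<in> El W"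
  unfolding El_def by simp_all

lemma sublattice_El: "sublattice01 Cl jn (\<inter>) (El W)"
proof -
  have "bot_of Cl (lat_le (\<inter>)) = {}"
    by (rule bot_of_eqI[OF po_Cl]) (simp_all add: lat_le_def)
  moreover have "top_of Cl (lat_le (\<inter>)) = UNIV"
    by (rule top_of_eqI[OF po_Cl]) (simp_all add: lat_le_def)
  ultimately show ?thesis
    using op_closed_El[of W] El_Cl[of _ W] unfolding sublattice01_def op_closed_def by auto
qed

section \<open>Congruences of the sublattices \<open>El W\<close>\<close>

abbreviation edge :: "'v set \<Rightarrow> 'v \<Rightarrow> ('a set \<times> 'a set) set" where
  "edge W v \<equiv> con (El W) jn (\<inter>) {ap v} {ap v, bp v}"

context
  fixes W :: "'v set" and \<theta>
  assumes \<theta>: "lat_congruence (El W) jn (\<inter>) \<theta>"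
begin

lemma cong_El: "(X, Y) \<in> \<theta> \<Longrightarrow> X \<in> El W" "(X, Y) \<in> \<theta> \<Longrightarrow> Y \<in> El W"
  using \<theta> unfolding lat_congruence_iff by blast+

lemma cong_refl: "X \<in> El W \<Longrightarrow> (X, X) \<in> \<theta>"
  using \<theta> unfolding lat_congruence_iff by blast

lemma cong_sym: "(X, Y) \<in> \<theta> \<Longrightarrow> (Y, X) \<in> \<theta>"
  using \<theta> unfolding lat_congruence_iff by blast

lemma cong_trans: "(X, Y) \<in> \<theta> \<Longrightarrow> (Y, Z) \<in> \<theta> \<Longrightarrow> (X, Z) \<in> \<theta>"
  using \<theta> unfolding lat_congruence_iff by blast

lemma cong_jn: "(X, Y) \<in> \<theta> \<Longrightarrow> Z \<in> El W \<Longrightarrow> (jn Z X, jn Z Y) \<in> \<theta>"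
  using \<theta> unfolding lat_congruence_iff by blast

lemma cong_Int: "(X, Y) \<in> \<theta> \<Longrightarrow> Z \<in> El W \<Longrightarrow> (X \<inter> Z, Y \<inter> Z) \<in> \<theta>"
  using \<theta> unfolding lat_congruence_iff by blast

lemma cong_bot_top_full:
  assumes "({}, UNIV) \<in> \<theta>"
  shows "\<theta> = El W \<times> El W"
proof -
  have "({}, X) \<in> \<theta>" if "X \<in> El W" for X
    using cong_Int[OF assms that] by simp
  then have "(X, Y) \<in> \<theta>" if "X \<in> El W" "Y \<in> El W" for X Y
    using cong_trans[OF cong_sym] that by blast
  moreover have "\<theta> \<subseteq> El W \<times> El W"
    using \<theta> unfolding lat_congruence_iff by blast
  ultimately show ?thesis by auto
qed

text \<open>The two filler atoms and any third atom are pairwise complementary, so that collapsing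
  anything with the bottom collapses everything.\<close>

lemma cong_bot_full:
  assumes X: "({}, X) \<in> \<theta>" "X \<noteq> {}" and "v \<in> W"
  shows "\<theta> = El W \<times> El W"
proof -
  have big: "({}, UNIV) \<in> \<theta>" if "({}, Y) \<in> \<theta>" "Y \<noteq> {}" "Y \<noteq> {u1}" "Y \<noteq> {u2}" for Y
  proof -
    have Y: "Y \<in> Cl" using that(1) cong_El El_Cl by blast
    have "({u1}, UNIV) \<in> \<theta>" "({u2}, UNIV) \<in> \<theta>"
      using cong_jn[OF that(1), of "{u1}"] cong_jn[OF that(1), of "{u2}"]
      using that Y by (simp_all add: jn_u1 jn_u2 jn_absorb)
    from cong_Int[OF this(1), of "{u2}"] this(2) show ?thesis
      using cong_trans by simp
  qed
  \<comment> \<open>If \<open>X\<close> is a filler, the third atom is \<open>{ap v}\<close>, whose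
    join with either filler is the top; this is where a vertex in \<open>W\<close> is
    needed.\<close>
  have "({}, {ap v}) \<in> \<theta>" if uX: "X = {u1} \<or> X = {u2}"
  proof -
    have u: "(jn {ap v} {}, UNIV) \<in> \<theta>"
      using cong_jn[OF X(1), of "{ap v}"] \<open>v \<in> W\<close> uX jn_u1[of "{ap v}"] jn_u2[of "{ap v}"]
      by (auto simp: jn_commute)
    then have "({ap v}, UNIV) \<in> \<theta>" by (simp add: jn_absorb)
    from cong_Int[OF this, of "{u1}"] cong_Int[OF this, of "{u2}"]
    have "({}, {u1}) \<in> \<theta>" "({}, {u2}) \<in> \<theta>" by simp_all
    from cong_jn[OF this(1), of "{u2}"] this(2) have "({}, UNIV) \<in> \<theta>"
      using cong_trans by (simp add: jn_u2 jn_absorb)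
    from cong_Int[OF this, of "{ap v}"] show ?thesis using \<open>v \<in> W\<close> by simp
  qed
  then have "({}, UNIV) \<in> \<theta>" using big[of X] big[of "{ap v}"] X by auto
  then show ?thesis by (rule cong_bot_top_full)
qed

text \<open>A small set misses at least one filler; meeting with that filler leaves the bottom
  paired with an atom.\<close>

lemma cong_top_full:
  assumes X: "(X, UNIV) \<in> \<theta>" "X \<noteq> UNIV" and "v \<in> W"
  shows "\<theta> = El W \<times> El W"
proof -
  have "small X" using X cong_El El_Cl Cl_cases by blast
  then have "u1 \<notin> X \<or> u2 \<notin> X" using small_u1 by force
  then have "({}, {u1}) \<in> \<theta> \<or> ({}, {u2}) \<in> \<theta>"
    using cong_Int[OF X(1), of "{u1}"] cong_Int[OF X(1), of "{u2}"] by auto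
  then show ?thesis using cong_bot_full[OF _ _ \<open>v \<in> W\<close>] by blast
qed

lemma cong_point_full:
  assumes "(X, Y) \<in> \<theta>" "x \<in> Y" "x \<notin> X" "{x} \<in> El W" and "v \<in> W"
  shows "\<theta> = El W \<times> El W"
  using cong_Int[OF assms(1,4)] assms cong_bot_full[of "{x}" v] by simp

text \<open>Joining the edge of \<open>w\<close> with \<open>{ap v, ap w}\<close> brings in
  \<open>bp v\<close> by the second Horn clause; meeting with \<open>{ap v, bp v}\<close> then
  leaves the edge of \<open>v\<close>.\<close>

lemma cong_edge_lo:
  assumes "lo v w" "v \<in> W" "w \<in> W" and e: "({ap w}, {ap w, bp w}) \<in> \<theta>"
  shows "({ap v}, {ap v, bp v}) \<in> \<theta>"
proof (cases "v = w")
  case False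
  let ?A = "{ap v, ap w}" and ?B = "jn {ap v, ap w} {ap w, bp w}"
  have "(jn ?A {ap w}, ?B) \<in> \<theta>" using assms by (intro cong_jn) simp_all
  then have "(?A, ?B) \<in> \<theta>" using assms by (simp add: jn_absorb)
  then have "(?A \<inter> {ap v, bp v}, ?B \<inter> {ap v, bp v}) \<in> \<theta>"
    using assms by (intro cong_Int) simp_all
  moreover have "?A \<inter> {ap v, bp v} = {ap v}" using False by auto
  moreover have "ap v \<in> ?B" "bp w \<in> ?B" using jn_superset[of ?A "{ap w, bp w}"] by auto
  moreover from this have "bp v \<in> ?B"
    using horn_Cl[of ?B] \<open>lo v w\<close> unfolding horn_def by (simp add: jn_def)
  ultimately show ?thesis by (simp add: Int_absorb1)
qed (use e in simp)

end

lemma edge_congruence: "v \<in> W \<Longrightarrow> lat_congruence (El W) jn (\<inter>) (edge W v)"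
  by (intro lat_congruence_con op_closed_El) simp_all

lemma edge_lo:
  assumes "lo v w" "v \<in> W" "w \<in> W"
  shows "edge W v \<subseteq> edge W w"
  using assms edge_congruence[of v] edge_congruence[of w]
  by (intro con_least cong_edge_lo[of _ _ v w] con_generator)

lemma edge_one:
  assumes "one v" "v \<in> W"
  shows "edge W v = El W \<times> El W"
  using cong_point_full[OF edge_congruence con_generator, of v W "bp v" v] assms by simp

text \<open>As in every lattice, a pair can be replaced by its meet and join, so only comparable
  pairs remain to be classified.\<close>

lemma con_order:
  assumes "X \<in> El W" "Y \<in> El W"
  shows "con (El W) jn (\<inter>) X Y = con (El W) jn (\<inter>) (X \<inter> Y) (jn X Y)"
proof -
  have cl: "X \<inter> Y \<in> El W" "jn X Y \<in> El W"
    using op_closed_El[of W] assms unfolding op_closed_def by auto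
  let ?c = "con (El W) jn (\<inter>) X Y" and ?d = "con (El W) jn (\<inter>) (X \<inter> Y) (jn X Y)"
  have c: "lat_congruence (El W) jn (\<inter>) ?c" and d: "lat_congruence (El W) jn (\<inter>) ?d"
    using assms cl by (simp_all add: lat_congruence_con op_closed_El)
  have 1: "(X \<inter> Y, Y) \<in> ?c"
    using cong_Int[OF c con_generator assms(2)] by simp
  have 2: "(Y, jn X Y) \<in> ?c"
    using cong_jn[OF c con_generator assms(2)] cong_sym[OF c]
    by (auto simp: jn_commute[of Y X] jn_absorb El_Cl[OF assms(2)])
  have *: "(X \<inter> Y, Z) \<in> ?d" if "Z \<in> {X, Y}" for Z
    using cong_Int[OF d con_generator, of Z] that assms jn_superset[of X Y]
    by (auto simp: Int_absorb1 Int_absorb2 Int_ac)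
  have "?d \<subseteq> ?c" using cong_trans[OF c 1 2] c by (intro con_least)
  moreover have "(X, Y) \<in> ?d"
    by (rule cong_trans[OF d cong_sym[OF d *[of X]] *[of Y]]) simp_all
  then have "?c \<subseteq> ?d" using d by (intro con_least)
  ultimately show ?thesis by blast
qed


end

text \<open>One level of the functor: \<open>c v\<close> is the color of a vertex, the element of
  \<open>P\<close> that its edge stands for, and \<open>s p\<close> is a representative vertex of
  color \<open>p\<close>. By \<open>lo_s_c\<close> each vertex is equivalent to the representative
  of its color.\<close>

locale level = frame ap bp u1 u2 lo one
  for ap bp :: "'v \<Rightarrow> 'a" and u1 u2 lo one +
  fixes W :: "'v set" and P :: "'p set" and le :: "'p \<Rightarrow> 'p \<Rightarrow> bool"
    and c :: "'v \<Rightarrow> 'p" and s :: "'p \<Rightarrow> 'v"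
  assumes P: "bounded_po P le"
    and nontrivial: "bot_of P le \<noteq> top_of P le"
    and c_P: "v \<in> W \<Longrightarrow> c v \<in> P" and c_bot: "v \<in> W \<Longrightarrow> c v \<noteq> bot_of P le"
    and s_W: "p \<in> P \<Longrightarrow> p \<noteq> bot_of P le \<Longrightarrow> s p \<in> W"
    and c_s: "p \<in> P \<Longrightarrow> p \<noteq> bot_of P le \<Longrightarrow> c (s p) = p"
    and lo_c: "lo v w \<Longrightarrow> v \<in> W \<Longrightarrow> w \<in> W \<Longrightarrow> le (c v) (c w)"
    and one_c: "one v \<Longrightarrow> v \<in> W \<Longrightarrow> c v = top_of P le"
    and lo_s: "p \<in> P \<Longrightarrow> q \<in> P \<Longrightarrow> p \<noteq> bot_of P le \<Longrightarrow> le p q \<Longrightarrow> lo (s p) (s q)"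
    and lo_s_c: "v \<in> W \<Longrightarrow> lo v (s (c v))" "v \<in> W \<Longrightarrow> lo (s (c v)) v"
    and one_s: "one (s (top_of P le))"
begin

abbreviation "z \<equiv> bot_of P le"
abbreviation "t \<equiv> top_of P le"
abbreviation "E \<equiv> El W"

lemma P_trans: "p \<in> P \<Longrightarrow> q \<in> P \<Longrightarrow> r \<in> P \<Longrightarrow> le p q \<Longrightarrow> le q r \<Longrightarrow> le p r"
  and P_antisym: "p \<in> P \<Longrightarrow> q \<in> P \<Longrightarrow> le p q \<Longrightarrow> le q p \<Longrightarrow> p = q"
  and P_refl: "p \<in> P \<Longrightarrow> le p p"
  using P unfolding bounded_po_def po_on_def by blast+

lemmas P_bounds [simp] = bounded_po_bot_top[OF P]

lemma s_t: "s t \<in> W"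
  using s_W[of t] nontrivial by auto

section \<open>Closure operators and their kernels\<close>

definition sat :: "'p \<Rightarrow> 'a set \<Rightarrow> 'a set" where
  "sat q C = C \<union> {bp v | v. v \<in> W \<and> ap v \<in> C \<and> le (c v) q}"

lemma ap_sat [simp]: "ap v \<in> sat q C \<longleftrightarrow> ap v \<in> C"
  unfolding sat_def by auto

lemma bp_sat: "bp v \<in> sat q C \<longleftrightarrow> bp v \<in> C \<or> v \<in> W \<and> ap v \<in> C \<and> le (c v) q"
  unfolding sat_def by auto

lemma sat_superset: "C \<subseteq> sat q C"
  unfolding sat_def by blast

lemma sat_mono: "C \<subseteq> D \<Longrightarrow> sat q C \<subseteq> sat q D"
  unfolding sat_def by blast

lemma sat_idem: "sat q (sat q C) = sat q C"
  unfolding sat_def by auto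

lemma small_sat:
  assumes "small C"
  shows "small (sat q C)"
proof -
  obtain B where B: "block B" "C \<subseteq> B" using assms unfolding small_def by blast
  have "bp v \<in> B" if "ap v \<in> B" for v
    using that B(1) unfolding block_def by auto
  with B(2) have "sat q C \<subseteq> B" unfolding sat_def by blast
  with B(1) show ?thesis by (rule smallI)
qed

lemma sat_El:
  assumes q: "q \<in> P" and C: "C \<in> E"
  shows "sat q C \<in> E"
proof (cases "C = UNIV")
  case False
  have CQ: "C \<subseteq> Q W" and sm: "small C" and hC: "horn C"
    using El_Q[OF C False] Cl_cases[OF El_Cl[OF C] False] horn_Cl[OF El_Cl[OF C]] by simp_all
  have W: "v \<in> W" if "ap v \<in> C \<or> bp v \<in> C" for v
    using that CQ by auto
  have "horn (sat q C)"
    unfolding horn_def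
  proof (intro conjI allI impI)
    fix v assume "\<not> one v" "bp v \<in> sat q C"
    then show "ap v \<in> sat q C" using hC unfolding horn_def bp_sat by auto
  next
    fix v w assume vw: "lo v w" "ap v \<in> sat q C" "bp w \<in> sat q C"
    show "bp v \<in> sat q C"
    proof (cases "bp w \<in> C")
      case True
      with vw show ?thesis using hC unfolding horn_def bp_sat by auto
    next
      \<comment> \<open>Now \<open>bp w\<close> is an added point, so the color of \<open>w\<close>
        is at most \<open>q\<close>, and \<open>lo v w\<close> bounds the color of \<open>v\<close>
        by that of \<open>w\<close>.\<close>
      case False
      with vw have "le (c w) q" "v \<in> W" "w \<in> W" "ap v \<in> C"
        using W unfolding bp_sat by auto
      with vw show ?thesis
        using lo_c[of v w] P_trans[of "c v" "c w" q] c_P q unfolding bp_sat by simp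
    qed
  qed
  moreover have "sat q C \<subseteq> Q W" using CQ unfolding sat_def by auto
  ultimately show ?thesis using small_sat[OF sm] unfolding El_def Cl_def by blast
qed (simp add: sat_def El_def)

text \<open>The critical point is a \<open>bp v\<close> that is old in \<open>X\<close> but added to
  \<open>Y\<close>: it needs \<open>ap v\<close> in \<open>X\<close>. Its color is at most
  \<open>q\<close>, hence not the top, so \<open>one v\<close> fails and the first Horn clause gives
  \<open>ap v\<close>.\<close>

lemma sat_Int:
  assumes q: "q \<in> P" "q \<noteq> t" and X: "X \<in> E" and Y: "Y \<in> E"
  shows "sat q (X \<inter> Y) = sat q X \<inter> sat q Y"
proof -
  have "ap v \<in> C" if "bp v \<in> C" "v \<in> W" "le (c v) q" "C \<in> E" for v C
  proof -
    have "c v \<noteq> t"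
    proof
      assume "c v = t"
      then have "q = t" using that(3) q P_antisym[of q t] by simp
      with q show False by simp
    qed
    then have "\<not> one v" using one_c that by blast
    then show ?thesis using horn_Cl[OF El_Cl[OF that(4)]] that(1) unfolding horn_def by blast
  qed
  then show ?thesis using X Y unfolding sat_def by auto
qed

text \<open>This makes the kernel respect joins, as for any closure operator:
  \<open>sat q (jn X Y)\<close> is a closed upper bound of \<open>sat q X\<close> and
  \<open>sat q Y\<close>.\<close>

lemma sat_jn:
  assumes "q \<in> P" "X \<in> E" "Y \<in> E"
  shows "sat q (jn X Y) = sat q (jn (sat q X) (sat q Y))"
proof
  show "sat q (jn X Y) \<subseteq> sat q (jn (sat q X) (sat q Y))"
    using sat_superset jn_superset[of "sat q X" "sat q Y"]
    by (intro sat_mono jn_least) (auto intro: sat_superset[THEN subsetD])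
  have "jn (sat q X) (sat q Y) \<subseteq> sat q (jn X Y)"
    using assms jn_superset[of X Y] by (intro jn_least sat_mono El_Cl[of _ W] sat_El jn_El) auto
  from sat_mono[OF this, of q] show "sat q (jn (sat q X) (sat q Y)) \<subseteq> sat q (jn X Y)"
    by (simp add: sat_idem)
qed

definition theta :: "'p \<Rightarrow> ('a set \<times> 'a set) set" where
  "theta q = {(X, Y). X \<in> E \<and> Y \<in> E \<and> sat q X = sat q Y}"

lemma theta_congruence:
  assumes "q \<in> P" "q \<noteq> t"
  shows "lat_congruence E jn (\<inter>) (theta q)"
  unfolding lat_congruence_iff
proof (intro conjI allI impI)
  fix X X' Y Y' assume *: "(X, X') \<in> theta q \<and> (Y, Y') \<in> theta q"
  then show "(jn X Y, jn X' Y') \<in> theta q"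
    using sat_jn[OF assms(1), of X Y] sat_jn[OF assms(1), of X' Y']
    unfolding theta_def by (simp add: jn_El)
  show "(X \<inter> Y, X' \<inter> Y') \<in> theta q"
    using * sat_Int[OF assms] op_closed_El[of W] unfolding theta_def op_closed_def by simp
qed (auto simp: theta_def)

section \<open>The isomorphism onto the principal congruences\<close>

definition lower :: "'p \<Rightarrow> 'a set" where
  "lower p = (if p = z then {} else {ap (s p)})"

definition upper :: "'p \<Rightarrow> 'a set" where
  "upper p = (if p = z then {} else {ap (s p), bp (s p)})"

text \<open>The bottom has no vertex; there \<open>lower\<close> and \<open>upper\<close> are both
  empty and generate the identity congruence.\<close>

definition xi :: "'p \<Rightarrow> ('a set \<times> 'a set) set" where
  "xi p = con E jn (\<inter>) (lower p) (upper p)"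

lemma lower_upper_El: "p \<in> P \<Longrightarrow> lower p \<in> E" "p \<in> P \<Longrightarrow> upper p \<in> E"
  unfolding lower_def upper_def using s_W by auto

lemma xi_edge: "p \<noteq> z \<Longrightarrow> xi p = edge W (s p)"
  unfolding xi_def lower_def upper_def by simp

lemma xi_t: "xi t = E \<times> E"
  using edge_one[OF one_s s_t] nontrivial by (simp add: xi_edge)

lemma xi_congruence: "p \<in> P \<Longrightarrow> lat_congruence E jn (\<inter>) (xi p)"
  unfolding xi_def by (intro lat_congruence_con op_closed_El lower_upper_El)

text \<open>The vertices \<open>v\<close> and \<open>s (c v)\<close> are below each other, so the
  congruence of an edge depends on its color only.\<close>

lemma edge_xi:
  assumes "v \<in> W"
  shows "edge W v = xi (c v)"
  using assms edge_lo[of v "s (c v)" W] edge_lo[of "s (c v)" v W] lo_s_c[of v] s_W[of "c v"]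
  by (simp add: xi_edge c_P c_bot subset_antisym)

text \<open>Monotonicity comes from \<open>edge_lo\<close>. Conversely, when \<open>q\<close> is not
  the top, the kernel \<open>theta q\<close> contains \<open>xi q\<close>, and it collapses the edge
  of \<open>s p\<close> only if the color \<open>p\<close> is at most \<open>q\<close>.\<close>

lemma xi_le_iff:
  assumes p: "p \<in> P" and q: "q \<in> P"
  shows "le p q \<longleftrightarrow> xi p \<subseteq> xi q"
proof
  assume le: "le p q"
  show "xi p \<subseteq> xi q"
  proof (cases "p = z")
    case True
    then have "lower p = upper p" unfolding lower_def upper_def by simp
    moreover have "(upper p, upper p) \<in> xi q"
      using cong_refl[OF xi_congruence] p q lower_upper_El by blast
    ultimately show ?thesis
      unfolding xi_def[of p] by (intro con_least xi_congruence q) simp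
  next
    case False
    then have "q \<noteq> z" using P_antisym[of p z] p le by auto
    with False show ?thesis
      using le p q by (simp add: xi_edge edge_lo lo_s s_W)
  qed
next
  assume sub: "xi p \<subseteq> xi q"
  show "le p q"
  proof (cases "q = t \<or> p = z")
    case True
    with p q show ?thesis by auto
  next
    case False
    have "(lower q, upper q) \<in> theta q"
      using q lower_upper_El[OF q] s_W[OF q] c_s[OF q] P_refl[OF q] unfolding theta_def
      by (auto simp: lower_def upper_def sat_def split: if_splits)
    then have "xi q \<subseteq> theta q"
      unfolding xi_def using False q by (intro con_least theta_congruence) simp_all
    moreover have "(lower p, upper p) \<in> xi p"
      unfolding xi_def by (rule con_generator)
    ultimately have "(lower p, upper p) \<in> theta q" using sub by blast
    then have "bp (s p) \<in> sat q {ap (s p)}"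
      using False sat_superset[of "{ap (s p), bp (s p)}" q]
      unfolding theta_def lower_def upper_def by auto
    then show ?thesis using c_s[OF p] False unfolding bp_sat by simp
  qed
qed

text \<open>A pair that does not generate the full congruence adds to its lower member at most two
  upper points; closing under the one with the larger color then adds the other.\<close>

lemma con_El_xi:
  assumes X: "X \<in> E" and Y: "Y \<in> E" and "X \<subseteq> Y"
  shows "\<exists>p\<in>P. con E jn (\<inter>) X Y = xi p"
proof (cases "con E jn (\<inter>) X Y = E \<times> E \<or> X = Y")
  case True
  have "con E jn (\<inter>) X X = Id_on E"
    using op_closed_El X by (rule con_refl)
  moreover have "xi z = Id_on E"
    using con_refl[OF op_closed_El, of "{}" W] by (simp add: xi_def lower_def upper_def)
  ultimately show ?thesis using True xi_t P_bounds(1,2) by metis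
next
  case False
  let ?C = "con E jn (\<inter>) X Y"
  have cong: "lat_congruence E jn (\<inter>) ?C" and XY: "(X, Y) \<in> ?C"
    using X Y by (simp_all add: lat_congruence_con op_closed_El con_generator)
  have "Y \<noteq> UNIV"
    using False XY cong_top_full[OF cong _ _ s_t] by metis
  then have YQ: "Y \<subseteq> Q W" and "small Y" and hY: "horn Y"
    using El_Q[OF Y] Cl_cases[OF El_Cl[OF Y]] horn_Cl[OF El_Cl[OF Y]] by simp_all
  have atom: "x \<notin> Y - X" if "{x} \<in> E" for x
    using False cong_point_full[OF cong XY _ _ that s_t] by blast
  \<comment> \<open>No point of \<open>Y - X\<close> has a closed singleton, so it is some
    \<open>bp v\<close> without \<open>one v\<close>. The first Horn clause puts \<open>ap v\<close>
    into \<open>Y\<close>, and since \<open>{ap v}\<close> is closed, \<open>ap v\<close> is already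
    in \<open>X\<close>.\<close>
  have new: "\<exists>v\<in>W. x = bp v \<and> ap v \<in> X \<and> ap v \<in> Y" if x: "x \<in> Y - X" for x
  proof -
    have "x \<noteq> u1" "x \<noteq> u2" "\<And>v. v \<in> W \<Longrightarrow> x \<noteq> ap v" "\<And>v. v \<in> W \<Longrightarrow> one v \<Longrightarrow> x \<noteq> bp v"
      using x atom by auto
    then obtain v where v: "v \<in> W" "x = bp v" "\<not> one v"
      using x YQ unfolding Q_def by blast
    then have "ap v \<in> Y" using x hY unfolding horn_def by blast
    with v atom[of "ap v"] show ?thesis by auto
  qed
  \<comment> \<open>\<open>w\<close> is the upper vertex of a block around \<open>Y\<close> if its
    upper point is new, and otherwise the only vertex with a new upper point.\<close>
  obtain w where w: "w \<in> W" "bp w \<in> Y - X" "ap w \<in> X"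
    and max: "\<And>v. bp v \<in> Y - X \<Longrightarrow> v = w \<or> lo v w"
  proof -
    obtain B where B: "block B" "Y \<subseteq> B" using \<open>small Y\<close> unfolding small_def by blast
    obtain x where x: "x \<in> Y - X" using False \<open>X \<subseteq> Y\<close> by blast
    obtain v1 where v1: "v1 \<in> W" "x = bp v1" "ap v1 \<in> X" using new[OF x] by blast
    have "bp v1 \<in> B" using x v1 B by auto
    with B(1) obtain v w where vw: "v = w \<or> lo v w" "B = {ap v, bp v, ap w, bp w}"
      unfolding block_def by auto
    then have vs: "v' = v \<or> v' = w" if "bp v' \<in> Y - X" for v'
      using that B(2) by auto
    show thesis
    proof (cases "bp w \<in> Y - X")
      case True
      then obtain "w \<in> W" "ap w \<in> X" using new[OF True] by auto
      then show thesis using True vs vw(1) by (intro that[of w]) blast+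
    next
      case False
      then have "v1 = v" using vs[of v1] v1 x by auto
      then show thesis using v1 x vs False by (intro that[of v]) auto
    qed
  qed
  \<comment> \<open>Meeting the pair with \<open>{ap w, bp w}\<close> gives the edge of
    \<open>w\<close>; conversely, joining that edge with \<open>X\<close> gives back the
    pair.\<close>
  have "(X \<inter> {ap w, bp w}, Y \<inter> {ap w, bp w}) \<in> ?C"
    using w(1) by (intro cong_Int[OF cong XY]) simp
  moreover have "X \<inter> {ap w, bp w} = {ap w}" "Y \<inter> {ap w, bp w} = {ap w, bp w}"
    using w \<open>X \<subseteq> Y\<close> by auto
  ultimately have "edge W w \<subseteq> ?C" using cong by (intro con_least) simp_all
  moreover have "(X, Y) \<in> edge W w"
  proof -
    have "(jn X {ap w}, jn X {ap w, bp w}) \<in> edge W w"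
      using edge_congruence[OF w(1)] X by (rule cong_jn[OF _ con_generator])
    moreover have "jn X {ap w} = X" using w El_Cl[OF X] by (simp add: jn_absorb)
    moreover have "jn X {ap w, bp w} = Y"
    proof
      show "jn X {ap w, bp w} \<subseteq> Y"
        using w \<open>X \<subseteq> Y\<close> El_Cl[OF Y] by (intro jn_least) auto
      let ?J = "jn X {ap w, bp w}"
      have J: "X \<subseteq> ?J" "bp w \<in> ?J" using jn_superset[of X "{ap w, bp w}"] by auto
      show "Y \<subseteq> ?J"
      proof
        fix x assume "x \<in> Y"
        show "x \<in> ?J"
        proof (cases "x \<in> X")
          case False
          then obtain v where v: "x = bp v" "ap v \<in> X" using new \<open>x \<in> Y\<close> by blast
          then have "v = w \<or> lo v w" using max \<open>x \<in> Y\<close> False by blast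
          then show ?thesis
            using v J horn_Cl[of ?J] unfolding horn_def by auto
        qed (use J in auto)
      qed
    qed
    ultimately show ?thesis by simp
  qed
  then have "?C \<subseteq> edge W w" using edge_congruence[OF w(1)] by (intro con_least)
  ultimately have "?C = xi (c w)" using edge_xi[OF w(1)] by simp
  then show ?thesis using c_P w(1) by blast
qed

lemma xi_bij: "bij_betw xi P (Princ E jn (\<inter>))"
proof (intro bij_betwI' iffI)
  fix p q assume "p \<in> P" "q \<in> P" "xi p = xi q"
  then show "p = q" using xi_le_iff P_antisym by (metis subset_refl)
next
  fix p assume "p \<in> P"
  then show "xi p \<in> Princ E jn (\<inter>)"
    unfolding Princ_def xi_def using lower_upper_El by blast
next
  fix \<phi> assume "\<phi> \<in> Princ E jn (\<inter>)"
  then obtain X Y where XY: "X \<in> E" "Y \<in> E" "\<phi> = con E jn (\<inter>) X Y"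
    unfolding Princ_def by blast
  moreover from this have "X \<inter> Y \<in> E" "jn X Y \<in> E"
    using op_closed_El[of W] unfolding op_closed_def by blast+
  moreover have "X \<inter> Y \<subseteq> jn X Y" using jn_superset[of X Y] by blast
  ultimately show "\<exists>p\<in>P. \<phi> = xi p"
    using con_El_xi[of "X \<inter> Y" "jn X Y"] con_order[of X W Y] by simp
qed simp

end

section \<open>Representing the functor\<close>

theorem theorem1:
  fixes S :: "'i set" and leS :: "'i \<Rightarrow> 'i \<Rightarrow> bool"
    and P :: "'i \<Rightarrow> 'p set" and le :: "'i \<Rightarrow> 'p \<Rightarrow> 'p \<Rightarrow> bool"
    and psi :: "'i \<Rightarrow> 'i \<Rightarrow> 'p \<Rightarrow> 'p"
  assumes S_bounded: "bounded_po S leS"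
    and P_bounded: "\<forall>i\<in>S. bounded_po (P i) (le i)"
    and psi_mor: "\<forall>i\<in>S. \<forall>j\<in>S. leS i j \<longrightarrow> sep01_mono (P i) (le i) (P j) (le j) (psi i j)"
    and psi_id: "\<forall>i\<in>S. \<forall>x\<in>P i. psi i i x = x"
    and psi_comp: "\<forall>i\<in>S. \<forall>j\<in>S. \<forall>k\<in>S. leS i j \<and> leS j k \<longrightarrow>
                     (\<forall>x\<in>P i. psi j k (psi i j x) = psi i k x)"
  shows "\<exists>(L :: ('i \<times> 'p \<times> nat) set set) jn mt E xi.
           bounded_lattice_on L jn mt \<and>
           (\<forall>i\<in>S. sublattice01 L jn mt (E i)) \<and>
           (\<forall>i\<in>S. \<forall>j\<in>S. leS i j \<longrightarrow> E i \<subseteq> E j) \<and>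
           (\<forall>i\<in>S. bij_betw (xi i) (P i) (Princ (E i) jn mt) \<and>
                   (\<forall>x\<in>P i. \<forall>y\<in>P i. le i x y \<longleftrightarrow> xi i x \<subseteq> xi i y)) \<and>
           (\<forall>i\<in>S. \<forall>j\<in>S. leS i j \<longrightarrow>
              (\<forall>x\<in>P i. zeta (E i) (E j) jn mt (xi i x) = xi j (psi i j x)))"
proof (cases "\<forall>i\<in>S. bot_of (P i) (le i) = top_of (P i) (le i)")
  \<comment> \<open>Every \<open>P i\<close> is a singleton, so the one-element lattice serves at
    every level, with one constant function as both operations.\<close>
  case True
  define jn :: "('i \<times> 'p \<times> nat) set \<Rightarrow> ('i \<times> 'p \<times> nat) set \<Rightarrow> ('i \<times> 'p \<times> nat) set"
    where "jn = (\<lambda>X Y. {})"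
  let ?L = "{{}} :: ('i \<times> 'p \<times> nat) set set"
  have one: "x = bot_of (P i) (le i)" if "i \<in> S" "x \<in> P i" for i x
  proof -
    have b: "bounded_po (P i) (le i)" using P_bounded that(1) by blast
    then have "le i x (bot_of (P i) (le i))" "le i (bot_of (P i) (le i)) x"
      using bounded_po_bot_top(3,4)[OF b that(2)] True that(1) by simp_all
    then show ?thesis
      using b bounded_po_bot_top(1)[OF b] that(2) unfolding bounded_po_def po_on_def by blast
  qed
  have sing: "P i = {bot_of (P i) (le i)}" if "i \<in> S" for i
    using one[OF that] bounded_po_bot_top(1)[of "P i" "le i"] P_bounded that by blast
  have cl: "op_closed ?L jn jn" unfolding op_closed_def jn_def by simp
  have con: "con ?L jn jn {} {} = Id_on ?L" using cl by (rule con_refl) simp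
  have lat: "bounded_lattice_on ?L jn jn"
    unfolding bounded_lattice_on_def lattice_on_def lat_le_def jn_def by simp
  have "bot_of ?L (lat_le jn) = {}" "top_of ?L (lat_le jn) = {}"
    by (intro bot_of_eqI top_of_eqI; simp add: po_on_def lat_le_def jn_def)+
  then have sub: "sublattice01 ?L jn jn ?L"
    unfolding sublattice01_def by (simp add: jn_def)
  have Princ: "Princ ?L jn jn = {Id_on ?L}" unfolding Princ_def using con by simp
  have zeta: "zeta ?L ?L jn jn (Id_on ?L) = Id_on ?L"
    using zeta_con[OF cl cl, of "{}" "{}"] con by simp
  have bij: "bij_betw (\<lambda>_. Id_on ?L) (P i) (Princ ?L jn jn) \<and>
      (\<forall>x\<in>P i. \<forall>y\<in>P i. le i x y \<longleftrightarrow> Id_on ?L \<subseteq> Id_on ?L)" if "i \<in> S" for i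
  proof
    have "bij_betw (\<lambda>_. Id_on ?L) {bot_of (P i) (le i)} {Id_on ?L}"
      by (simp add: bij_betw_def)
    then show "bij_betw (\<lambda>_. Id_on ?L) (P i) (Princ ?L jn jn)"
      unfolding Princ using sing[OF that] by metis
    show "\<forall>x\<in>P i. \<forall>y\<in>P i. le i x y \<longleftrightarrow> Id_on ?L \<subseteq> Id_on ?L"
      using one[OF that] P_bounded that unfolding bounded_po_def po_on_def by (metis subset_refl)
  qed
  show ?thesis
    by (rule exI[of _ ?L], rule exI[of _ jn], rule exI[of _ jn], rule exI[of _ "\<lambda>_. ?L"],
        rule exI[of _ "\<lambda>_ _. Id_on ?L"]) (use lat sub bij zeta in simp)
next
  case False
  define z where "z i = bot_of (P i) (le i)" for i
  define t where "t i = top_of (P i) (le i)" for i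
  have P: "bounded_po (P i) (le i)" if "i \<in> S" for i
    using P_bounded that by blast
  have S_po: "leS i i" "leS i j \<Longrightarrow> leS j k \<Longrightarrow> leS i k" if "i \<in> S" "j \<in> S" "k \<in> S" for i j k
    using S_bounded that unfolding bounded_po_def po_on_def by blast+
  have psi: "x \<in> P i \<Longrightarrow> psi i j x \<in> P j" "psi i j (z i) = z j" "psi i j (t i) = t j"
      "x \<in> P i \<Longrightarrow> y \<in> P i \<Longrightarrow> le i x y \<Longrightarrow> le j (psi i j x) (psi i j y)"
      "x \<in> P i \<Longrightarrow> psi i j x = z j \<Longrightarrow> x = z i" if "i \<in> S" "j \<in> S" "leS i j" for i j x y
    using psi_mor that unfolding sep01_mono_def z_def t_def by blast+
  have P_refl: "le i x x" if "i \<in> S" "x \<in> P i" for i x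
    using P[OF that(1)] that(2) unfolding bounded_po_def po_on_def by blast
  \<comment> \<open>If bottom and top coincide in one \<open>P i\<close>, 0-separation of the map
    from the least level \<open>b\<close> makes them coincide in \<open>P b\<close>, and the maps
    out of \<open>P b\<close> spread this to every level.\<close>
  have nontrivial: "z i \<noteq> t i" if i: "i \<in> S" for i
  proof
    assume zt: "z i = t i"
    define b where "b = bot_of S leS"
    have b: "b \<in> S" "\<And>j. j \<in> S \<Longrightarrow> leS b j"
      unfolding b_def using bounded_po_bot_top[OF S_bounded] by auto
    have "psi b i (t b) = z i" using psi(3)[of b i] b i zt by simp
    moreover have "t b \<in> P b" unfolding t_def using bounded_po_bot_top(2)[OF P] b by blast
    ultimately have "t b = z b" using psi(5)[of b i] b i by blast
    then have "t j = z j" if "j \<in> S" for j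
      using psi(2,3)[of b j] b that by simp
    then show False using False unfolding t_def z_def by auto
  qed

  \<comment> \<open>The last component tags the kind of a point; the fillers have tags of their own,
    so their \<open>undefined\<close> components are harmless.\<close>
  define ap :: "'i \<times> 'p \<Rightarrow> 'i \<times> 'p \<times> nat" where "ap v = (fst v, snd v, 0)" for v
  define bp :: "'i \<times> 'p \<Rightarrow> 'i \<times> 'p \<times> nat" where "bp v = (fst v, snd v, 1)" for v
  define u1 :: "'i \<times> 'p \<times> nat" where "u1 = (undefined, undefined, 2)"
  define u2 :: "'i \<times> 'p \<times> nat" where "u2 = (undefined, undefined, 3)"
  \<comment> \<open>The link between a vertex and its \<open>psi\<close> image goes both ways. No
    transitive closure is taken, so colors need comparing only in these generating cases.\<close>
  define lo :: "'i \<times> 'p \<Rightarrow> 'i \<times> 'p \<Rightarrow> bool" where "lo = (\<lambda>(i, p) (j, q). i = j \<and> le i p q \<or>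
    leS i j \<and> psi i j p = q \<or> leS j i \<and> psi j i q = p)"
  define one :: "'i \<times> 'p \<Rightarrow> bool" where "one = (\<lambda>(i, p). p = t i)"
  \<comment> \<open>Level \<open>k\<close> sees the vertices of all levels up to \<open>k\<close>.
    Their colors are their images in \<open>P k\<close>, nonzero by 0-separation;
    \<open>(k, p)\<close> itself represents the color \<open>p\<close>.\<close>
  define W :: "'i \<Rightarrow> ('i \<times> 'p) set"
    where "W k = {(i, p). i \<in> S \<and> leS i k \<and> p \<in> P i \<and> p \<noteq> z i}" for k
  define c :: "'i \<Rightarrow> 'i \<times> 'p \<Rightarrow> 'p" where "c k = (\<lambda>(i, p). psi i k p)" for k

  interpret frame ap bp u1 u2 lo one
    by unfold_locales (auto simp: ap_def bp_def u1_def u2_def prod_eq_iff)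

  have level: "level ap bp u1 u2 lo one (W k) (P k) (le k) (c k) (Pair k)" if k: "k \<in> S" for k
  proof (unfold_locales, fold z_def t_def)
    show "bounded_po (P k) (le k)" using P k by blast
    show "z k \<noteq> t k" using nontrivial k by blast
    show "c k v \<in> P k" "c k v \<noteq> z k" if "v \<in> W k" for v
      using that k psi(1,5)[of _ k] unfolding W_def c_def by auto
    show "(k, p) \<in> W k" "c k (k, p) = p" if "p \<in> P k" "p \<noteq> z k" for p
      using that k S_po(1)[OF k k k] psi_id unfolding W_def c_def by auto
    show "c k v = t k" if "one v" "v \<in> W k" for v
      using that k psi(3)[of _ k] unfolding W_def c_def one_def by auto
    show "lo (k, p) (k, q)" if "le k p q" for p q
      using that unfolding lo_def by simp
    show "lo v (k, c k v)" "lo (k, c k v) v" if "v \<in> W k" for v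
      using that unfolding W_def lo_def c_def by auto
    show "one (k, t k)" unfolding one_def by simp
    \<comment> \<open>Within a level this is monotonicity of \<open>psi\<close>; across levels the
      composition law makes the two colors equal.\<close>
    show "le k (c k v) (c k w)" if lo: "lo v w" and vw: "v \<in> W k" "w \<in> W k" for v w
    proof -
      obtain i p j q where eq: "v = (i, p)" "w = (j, q)" by fastforce
      have v: "i \<in> S" "leS i k" "p \<in> P i" and w: "j \<in> S" "leS j k" "q \<in> P j"
        using vw unfolding eq W_def by auto
      have "le k (psi i k p) (psi j k q)"
        using lo unfolding eq lo_def prod.case
      proof (elim disjE conjE)
        assume "i = j" "le i p q"
        then show ?thesis using v w k psi(4) by blast
      next
        assume "leS i j" "psi i j p = q"
        then have "psi j k q = psi i k p" using psi_comp v w k by blast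
        then show ?thesis using P_refl[OF k] psi(1)[OF v(1) k v(2,3)] by simp
      next
        assume "leS j i" "psi j i q = p"
        then have "psi i k p = psi j k q" using psi_comp v w k by blast
        then show ?thesis using P_refl[OF k] psi(1)[OF v(1) k v(2,3)] by simp
      qed
      then show ?thesis unfolding eq c_def by simp
    qed
  qed
  define xi where "xi k = level.xi ap bp u1 u2 lo one (W k) (P k) (le k) (Pair k)" for k
  have E_mono: "El (W i) \<subseteq> El (W j)" if "i \<in> S" "j \<in> S" "leS i j" for i j
    using S_po(2)[OF _ that(1,2) _ that(3)] by (intro El_mono) (auto simp: W_def)
  have bij: "bij_betw (xi k) (P k) (Princ (El (W k)) jn (\<inter>)) \<and>
      (\<forall>x\<in>P k. \<forall>y\<in>P k. le k x y \<longleftrightarrow> xi k x \<subseteq> xi k y)" if "k \<in> S" for k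
    using level.xi_bij[OF level[OF that]] level.xi_le_iff[OF level[OF that]]
    unfolding xi_def by blast
  have zeta: "zeta (El (W i)) (El (W j)) jn (\<inter>) (xi i x) = xi j (psi i j x)"
    if ij: "i \<in> S" "j \<in> S" "leS i j" and x: "x \<in> P i" for i j x
  proof -
    interpret I: level ap bp u1 u2 lo one "W i" "P i" "le i" "c i" "Pair i" by (rule level[OF ij(1)])
    interpret J: level ap bp u1 u2 lo one "W j" "P j" "le j" "c j" "Pair j" by (rule level[OF ij(2)])
    have "zeta (El (W i)) (El (W j)) jn (\<inter>) (I.xi x) = con (El (W j)) jn (\<inter>) (I.lower x) (I.upper x)"
      unfolding I.xi_def
      by (intro zeta_con op_closed_El E_mono ij I.lower_upper_El x)
    also have "\<dots> = J.xi (psi i j x)"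
    proof (cases "x = z i")
      case True
      then show ?thesis using psi(2)[OF ij]
        unfolding J.xi_def I.lower_def I.upper_def J.lower_def J.upper_def z_def by simp
    next
      \<comment> \<open>The generating pair of \<open>I.xi x\<close> is the edge of
        \<open>(i, x)\<close>, which is also a vertex of \<open>W j\<close>, with color
        \<open>psi i j x\<close>.\<close>
      case False
      then have "(i, x) \<in> W j" using ij x unfolding W_def by auto
      from J.edge_xi[OF this] show ?thesis
        using False unfolding I.lower_def I.upper_def c_def z_def by simp
    qed
    finally show ?thesis unfolding xi_def .
  qed
  show ?thesis
    by (rule exI[of _ Cl], rule exI[of _ jn], rule exI[of _ "(\<inter>)"], rule exI[of _ "\<lambda>i. El (W i)"],
        rule exI[of _ xi]) (use bounded_lattice_Cl sublattice_El E_mono bij zeta in blast)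
qed

end
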